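(* Let $R=\Bbbk[[t^{a_1},t^{a_2},\ldots,t^{a_n}]]$ be a complete numerical semigroup ring which is almost Gorenstein of type $2$, with conductor valuation $c$. Then $R$ is of maximal reduced type if and only if $c\leq 2a_1-1$, and $R$ is of minimal reduced type if and only if $c>2a_1-1$.
   Context: $\Bbbk$ is an algebraically closed field of characteristic $0$. A numerical semigroup is a submonoid $H$ of $\mathbb N=\{0,1,2,\dots\}$ with finite complement; here $H\ne\mathbb N$ is minimally generated by $a_1<\dots<a_n$, and $R=\Bbbk[[H]]\subseteq\overline R=\Bbbk[[t]]$, with maximal ideal $\mathfrak m$. The conductor valuation $c$ is the least integer with $c+i\in H$ for all $i\ge 0$; the conductor of $R$ is $\mathfrak C=R:_{\operatorname{Frac}(R)}\overline R=t^c\overline R$. The reduced type is $s(R)=\dim_\Bbbk\frac{\mathfrak C+t^{a_1}R}{t^{a_1}R}$ and the Cohen–Macaulay type is $\operatorname{type}(R)=\dim_\Bbbk\frac{t^{a_1}R:_R\mathfrak m}{t^{a_1}R}$; one has $1\le s(R)\le\operatorname{type}(R)$. $R$ is of maximal reduced type if $s(R)=\operatorname{type}(R)$ and of minimal reduced type if $s(R)=1$. $R$ is almost Gorenstein if $\ell(\overline R/R)=\ell(R/\mathfrak C)+\operatorname{type}(R)-1$, where $\ell$ denotes length. *)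

theory Defs
  imports
    "HOL-Library.Set_Algebras"
    "HOL-Library.Extended_Nat"
    "HOL-Computational_Algebra.Computational_Algebra"
begin

definition numerical_semigroup :: "nat set \<Rightarrow> bool" where
  "numerical_semigroup H \<longleftrightarrow>
     0 \<in> H \<and> (\<forall>x\<in>H. \<forall>y\<in>H. x + y \<in> H) \<and> finite (UNIV - H)"

definition submonoid_generated :: "nat set \<Rightarrow> nat set" where
  "submonoid_generated A = \<Inter>{M. A \<subseteq> M \<and> 0 \<in> M \<and> (\<forall>x\<in>M. \<forall>y\<in>M. x + y \<in> M)}"

definition minimally_generates :: "nat set \<Rightarrow> nat set \<Rightarrow> bool" where
  "minimally_generates A H \<longleftrightarrow>
     submonoid_generated A = H \<and> (\<forall>B. B \<subset> A \<longrightarrow> submonoid_generated B \<noteq> H)"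

definition conductor_val :: "nat set \<Rightarrow> nat" where
  "conductor_val H = (LEAST c. \<forall>i. c + i \<in> H)"

text \<open>
  All rings, ideals and fractional ideals below are subsets of the field of formal Laurent
  series: \<open>normalization\<close> is the ring of formal power series in \<open>t\<close> (\<open>t\<close> being \<open>fls_X\<close>), and
  \<open>semigroup_ring H\<close> is its subring of series supported in \<open>H\<close>.
\<close>

definition normalization :: "'k::field fls set" where
  "normalization = range fps_to_fls"

definition semigroup_ring :: "nat set \<Rightarrow> 'k::field fls set" where
  "semigroup_ring H = fps_to_fls ` {f. \<forall>n. fps_nth f n \<noteq> 0 \<longrightarrow> n \<in> H}"

definition frac_field :: "'a::field set \<Rightarrow> 'a set" where
  "frac_field R = {f / g | f g. f \<in> R \<and> g \<in> R \<and> g \<noteq> 0}"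

text \<open>\<open>colon K I J\<close> is \<open>I :\<^sub>K J\<close>.\<close>

definition colon :: "'a::comm_ring_1 set \<Rightarrow> 'a set \<Rightarrow> 'a set \<Rightarrow> 'a set" where
  "colon K I J = {x \<in> K. \<forall>y\<in>J. x * y \<in> I}"

definition conductor :: "'k::field fls set \<Rightarrow> 'k fls set" where
  "conductor R = colon (frac_field R) R normalization"

definition is_submodule :: "'a::comm_ring_1 set \<Rightarrow> 'a set \<Rightarrow> bool" where
  "is_submodule R M \<longleftrightarrow>
     0 \<in> M \<and> (\<forall>x\<in>M. \<forall>y\<in>M. x + y \<in> M) \<and> (\<forall>r\<in>R. \<forall>x\<in>M. r * x \<in> M)"

definition is_ideal :: "'a::comm_ring_1 set \<Rightarrow> 'a set \<Rightarrow> bool" where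
  "is_ideal R I \<longleftrightarrow> I \<subseteq> R \<and> is_submodule R I"

definition is_maximal_ideal :: "'a::comm_ring_1 set \<Rightarrow> 'a set \<Rightarrow> bool" where
  "is_maximal_ideal R M \<longleftrightarrow>
     is_ideal R M \<and> M \<noteq> R \<and> (\<forall>I. is_ideal R I \<longrightarrow> M \<subseteq> I \<longrightarrow> I = M \<or> I = R)"

definition max_ideal :: "'a::comm_ring_1 set \<Rightarrow> 'a set" where
  "max_ideal R = (THE M. is_maximal_ideal R M)"

text \<open>
  \<open>quot_length R M N\<close> is the length of the \<open>R\<close>-module \<open>M / N\<close> (for submodules \<open>N \<subseteq> M\<close>): the
  supremum of the lengths of chains of submodules of \<open>M / N\<close>, written as submodules of \<open>M\<close>
  that contain \<open>N\<close>.
\<close>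

definition quot_length :: "'a::comm_ring_1 set \<Rightarrow> 'a set \<Rightarrow> 'a set \<Rightarrow> enat" where
  "quot_length R M N =
     Sup {enat l | l. \<exists>P :: nat \<Rightarrow> 'a set. P 0 = N \<and> P l = M \<and>
            (\<forall>i\<le>l. is_submodule R (P i)) \<and> (\<forall>i<l. P i \<subset> P (Suc i))}"

text \<open>
  For subspaces \<open>U \<subseteq> W\<close>, \<open>indep_modulo U B\<close> says that the cosets \<open>b + U\<close>, for \<open>b\<close> in the finite
  set \<open>B\<close>, are distinct and linearly independent over the coefficient field; \<open>quot_dim W U\<close> is
  the dimension of \<open>W / U\<close>.
\<close>

definition indep_modulo :: "'k::field fls set \<Rightarrow> 'k fls set \<Rightarrow> bool" where
  "indep_modulo U B \<longleftrightarrow>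
     finite B \<and> (\<forall>u. (\<Sum>b\<in>B. fls_const (u b) * b) \<in> U \<longrightarrow> (\<forall>b\<in>B. u b = 0))"

definition quot_dim :: "'k::field fls set \<Rightarrow> 'k fls set \<Rightarrow> enat" where
  "quot_dim W U = Sup {enat (card B) | B. B \<subseteq> W \<and> indep_modulo U B}"

text \<open>In the following, \<open>e\<close> is the multiplicity of the semigroup.\<close>

definition reduced_type :: "nat \<Rightarrow> 'k::field fls set \<Rightarrow> enat" where
  "reduced_type e R = quot_dim (conductor R + (fls_X ^ e) *o R) ((fls_X ^ e) *o R)"

definition cm_type :: "nat \<Rightarrow> 'k::field fls set \<Rightarrow> enat" where
  "cm_type e R = quot_dim (colon R ((fls_X ^ e) *o R) (max_ideal R)) ((fls_X ^ e) *o R)"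

definition maximal_reduced_type :: "nat \<Rightarrow> 'k::field fls set \<Rightarrow> bool" where
  "maximal_reduced_type e R \<longleftrightarrow> reduced_type e R = cm_type e R"

definition minimal_reduced_type :: "nat \<Rightarrow> 'k::field fls set \<Rightarrow> bool" where
  "minimal_reduced_type e R \<longleftrightarrow> reduced_type e R = 1"

definition almost_gorenstein :: "nat \<Rightarrow> 'k::field fls set \<Rightarrow> bool" where
  "almost_gorenstein e R \<longleftrightarrow>
     quot_length R normalization R = quot_length R R (conductor R) + cm_type e R - 1"

text \<open>
  Consistency checks: the ring is local with the expected maximal ideal, and its conductor is
  the expected ideal of the normalization.
\<close>

lemma semigroup_ring_nth:
  assumes "f \<in> semigroup_ring H" "fls_nth f (int n) \<noteq> 0"
  shows "n \<in> H"
  using assms by (auto simp: semigroup_ring_def)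

lemma semigroup_ring_mult:
  assumes H: "numerical_semigroup H" and f: "f \<in> semigroup_ring H" and g: "g \<in> semigroup_ring H"
  shows "f * g \<in> semigroup_ring H"
proof -
  obtain f' g' where f': "f = fps_to_fls f'" "\<forall>n. fps_nth f' n \<noteq> 0 \<longrightarrow> n \<in> H"
    and g': "g = fps_to_fls g'" "\<forall>n. fps_nth g' n \<noteq> 0 \<longrightarrow> n \<in> H"
    using f g by (auto simp: semigroup_ring_def)
  have "n \<in> H" if nz: "fps_nth (f' * g') n \<noteq> 0" for n
  proof -
    obtain i where i: "i \<le> n" "fps_nth f' i * fps_nth g' (n - i) \<noteq> 0"
      using nz unfolding fps_mult_nth by (meson atLeastAtMost_iff sum.neutral)
    then have "i \<in> H" "n - i \<in> H" using f' g' by auto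
    then have "i + (n - i) \<in> H" using H by (auto simp: numerical_semigroup_def)
    then show ?thesis using i by simp
  qed
  then show ?thesis
    unfolding semigroup_ring_def f'(1) g'(1)
    by (intro image_eqI[where x = "f' * g'"]) (auto simp: fls_times_fps_to_fls)
qed

lemma semigroup_ring_unit:
  fixes f :: "'k::field fls"
  assumes H: "numerical_semigroup H" and f: "f \<in> semigroup_ring H" and f0: "fls_nth f 0 \<noteq> 0"
  shows "\<exists>g\<in>semigroup_ring H. g * f = 1"
proof -
  obtain f' where f': "f = fps_to_fls f'" "\<forall>n. fps_nth f' n \<noteq> 0 \<longrightarrow> n \<in> H"
    using f by (auto simp: semigroup_ring_def)
  have f0': "fps_nth f' 0 \<noteq> 0" using f0 f' by simp
  define g where "g = inverse f'"
  have fg: "f' * g = 1" using f0' by (simp add: g_def inverse_mult_eq_1')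
  have gH: "fps_nth g n \<noteq> 0 \<longrightarrow> n \<in> H" for n
  proof (induction n rule: less_induct)
    case (less n)
    show ?case
    proof
      assume gn: "fps_nth g n \<noteq> 0"
      show "n \<in> H"
      proof (cases "n = 0")
        case True
        then show ?thesis using H by (simp add: numerical_semigroup_def)
      next
        case False
        have "0 = fps_nth (f' * g) n" using fg False by simp
        also have "\<dots> = (\<Sum>i=0..n. fps_nth f' i * fps_nth g (n - i))" by (simp add: fps_mult_nth)
        also have "\<dots> = fps_nth f' 0 * fps_nth g n + (\<Sum>i=1..n. fps_nth f' i * fps_nth g (n - i))"
          by (simp add: sum.atLeast_Suc_atMost)
        finally have "(\<Sum>i=1..n. fps_nth f' i * fps_nth g (n - i)) \<noteq> 0"
          using gn f0' by auto
        then obtain i where i: "1 \<le> i" "i \<le> n" "fps_nth f' i * fps_nth g (n - i) \<noteq> 0"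
          by (meson atLeastAtMost_iff sum.neutral)
        then have "i \<in> H" "n - i \<in> H" using f' less[of "n - i"] by auto
        then have "i + (n - i) \<in> H" using H by (auto simp: numerical_semigroup_def)
        then show ?thesis using i by simp
      qed
    qed
  qed
  have "fps_to_fls g * f = 1"
    unfolding f'(1) by (metis fg fls_times_fps_to_fls fps_one_to_fls mult.commute)
  moreover have "fps_to_fls g \<in> semigroup_ring H"
    using gH by (auto simp: semigroup_ring_def)
  ultimately show ?thesis by blast
qed

lemma semigroup_ring_add:
  assumes "f \<in> semigroup_ring H" "g \<in> semigroup_ring H"
  shows "f + g \<in> semigroup_ring H"
proof -
  obtain f' g' where f': "f = fps_to_fls f'" "\<forall>n. fps_nth f' n \<noteq> 0 \<longrightarrow> n \<in> H"
    and g': "g = fps_to_fls g'" "\<forall>n. fps_nth g' n \<noteq> 0 \<longrightarrow> n \<in> H"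
    using assms by (auto simp: semigroup_ring_def)
  have "n \<in> H" if "fps_nth (f' + g') n \<noteq> 0" for n
    using that f' g' by (metis add.right_neutral fps_add_nth)
  then show ?thesis
    unfolding semigroup_ring_def f'(1) g'(1)
    by (intro image_eqI[where x = "f' + g'"]) auto
qed

lemma semigroup_ring_0: "0 \<in> semigroup_ring H"
  unfolding semigroup_ring_def by (intro image_eqI[where x = 0]) auto

lemma semigroup_ring_1:
  assumes "numerical_semigroup H"
  shows "1 \<in> semigroup_ring H"
  unfolding semigroup_ring_def using assms
  by (intro image_eqI[where x = 1]) (auto simp: numerical_semigroup_def)

lemma semigroup_ring_maximal_ideal_iff:
  fixes M :: "'k::field fls set"
  assumes H: "numerical_semigroup H"
  shows "is_maximal_ideal (semigroup_ring H) M \<longleftrightarrow>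
           M = {f \<in> semigroup_ring H. fls_nth f 0 = 0}"
proof -
  define R where "R = (semigroup_ring H :: 'k fls set)"
  define N where "N = {f \<in> R. fls_nth f 0 = 0}"
  have nth0: "fls_nth (f * g) 0 = fls_nth f 0 * fls_nth g 0" if "f \<in> R" "g \<in> R" for f g
    using that by (auto simp: R_def semigroup_ring_def simp flip: fls_times_fps_to_fls)
  have idN: "is_ideal R N"
    unfolding is_ideal_def is_submodule_def N_def using nth0 H
    by (auto simp: R_def semigroup_ring_0 semigroup_ring_add semigroup_ring_mult)
  have one: "1 \<in> R" using H by (simp add: R_def semigroup_ring_1)
  moreover have "1 \<notin> N" by (simp add: N_def)
  ultimately have neq: "N \<noteq> R" by blast
  have sub: "I = R \<or> I \<subseteq> N" if I: "is_ideal R I" for I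
  proof (rule disjCI)
    assume "\<not> I \<subseteq> N"
    then obtain f where f: "f \<in> I" "f \<in> R" "fls_nth f 0 \<noteq> 0"
      using I by (auto simp: N_def is_ideal_def)
    then obtain g where "g \<in> R" "g * f = 1"
      using semigroup_ring_unit[OF H] by (auto simp: R_def)
    then have "1 \<in> I" using I f by (metis is_ideal_def is_submodule_def)
    then have "R \<subseteq> I" using I by (metis is_ideal_def is_submodule_def mult.right_neutral subsetI)
    then show "I = R" using I by (auto simp: is_ideal_def)
  qed
  have "is_maximal_ideal R M \<longleftrightarrow> M = N"
  proof
    assume M: "is_maximal_ideal R M"
    then have "M \<subseteq> N" using sub[of M] by (auto simp: is_maximal_ideal_def)
    then have "N = M \<or> N = R" using M idN unfolding is_maximal_ideal_def by blast
    then show "M = N" using neq by simp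
  next
    assume M: "M = N"
    have "I = N \<or> I = R" if "is_ideal R I" "N \<subseteq> I" for I
      using sub[OF that(1)] that(2) by blast
    then show "is_maximal_ideal R M" using idN neq by (simp add: M is_maximal_ideal_def)
  qed
  then show ?thesis by (simp add: R_def N_def)
qed

lemma max_ideal_semigroup_ring:
  assumes "numerical_semigroup H"
  shows "max_ideal (semigroup_ring H :: 'k::field fls set) =
           {f \<in> semigroup_ring H. fls_nth f 0 = 0}"
  unfolding max_ideal_def semigroup_ring_maximal_ideal_iff[OF assms] by (rule the_equality) auto

lemma conductor_semigroup_ring:
  assumes H: "numerical_semigroup H"
  shows "conductor (semigroup_ring H :: 'k::field fls set) =
           (fls_X ^ conductor_val H) *o normalization"
proof -
  define R where "R = (semigroup_ring H :: 'k fls set)"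
  define c where "c = conductor_val H"
  have "\<exists>c. \<forall>i. c + i \<in> H"
  proof -
    have "finite (UNIV - H)" using H by (simp add: numerical_semigroup_def)
    then obtain b where b: "\<forall>x\<in>UNIV - H. x < b" using finite_nat_set_iff_bounded by blast
    have "b + i \<in> H" for i using b[rule_format, of "b + i"] by auto
    then show ?thesis by blast
  qed
  then have c: "c + i \<in> H" for i
    using LeastI_ex[of "\<lambda>c. \<forall>i. c + i \<in> H"] by (auto simp: c_def conductor_val_def)
  have c_le: "c \<le> n" if "\<And>i. n + i \<in> H" for n
    unfolding c_def conductor_val_def using that by (intro Least_le) auto
  show ?thesis unfolding R_def[symmetric] c_def[symmetric]
  proof (intro equalityI subsetI)
    fix x assume "x \<in> conductor R"
    then have x: "x * y \<in> R" if "y \<in> normalization" for y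
      using that by (auto simp: conductor_def colon_def)
    have "x * fps_to_fls 1 \<in> R" by (rule x) (auto simp: normalization_def)
    then obtain f where f: "x = fps_to_fls f" by (auto simp: R_def semigroup_ring_def)
    have "\<exists>h. f = fps_X ^ c * h"
    proof (cases "f = 0")
      case False
      define n where "n = subdegree f"
      have "n + i \<in> H" for i
      proof -
        have "x * fps_to_fls (fps_X ^ i) \<in> R" by (rule x) (auto simp: normalization_def)
        moreover have "x * fps_to_fls (fps_X ^ i) = fps_to_fls (f * fps_X ^ i)"
          by (simp add: f fls_times_fps_to_fls)
        moreover have "fps_nth (f * fps_X ^ i) (n + i) \<noteq> 0"
          using False by (simp add: fps_X_power_mult_right_nth n_def)
        moreover have "fls_nth (fps_to_fls g) (int m) = fps_nth g m" for g :: "'k fps" and m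
          by simp
        ultimately show ?thesis
          unfolding R_def by (metis semigroup_ring_nth)
      qed
      then have "c \<le> subdegree f" using c_le n_def by blast
      then have "fps_X ^ c dvd f" using False
        by (subst fps_dvd_iff) (simp_all add: fps_X_power_subdegree)
      then show ?thesis by (simp only: dvd_def)
    next
      case True
      then show ?thesis by (intro exI[of _ 0]) simp
    qed
    then obtain h where "f = fps_X ^ c * h" by blast
    then have "x = fls_X ^ c * fps_to_fls h"
      by (simp add: f fls_times_fps_to_fls fps_to_fls_power)
    then show "x \<in> (fls_X ^ c) *o normalization"
      by (auto simp: elt_set_times_def normalization_def)
  next
    have inR: "fls_X ^ c * fps_to_fls h \<in> R" for h
    proof -
      have "n \<in> H" if "fps_nth (fps_X ^ c * h) n \<noteq> 0" for n
        using that c[of "n - c"] by (auto simp: fps_X_power_mult_nth split: if_splits)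
      then show ?thesis unfolding R_def semigroup_ring_def
        by (intro image_eqI[where x = "fps_X ^ c * h"])
          (auto simp: fls_times_fps_to_fls fps_to_fls_power)
    qed
    fix x assume "x \<in> (fls_X ^ c) *o (normalization :: 'k fls set)"
    then obtain h where h: "x = fls_X ^ c * fps_to_fls h"
      by (auto simp: elt_set_times_def normalization_def)
    have "x \<in> R" using inR h by simp
    moreover have "(1 :: 'k fls) \<in> R" using semigroup_ring_1[OF H] by (simp add: R_def)
    moreover have "x = x / 1" by simp
    ultimately have "x \<in> frac_field R"
      unfolding frac_field_def using one_neq_zero by blast
    moreover have "x * y \<in> R" if y: "y \<in> normalization" for y
    proof -
      obtain g where "y = fps_to_fls g" using y by (auto simp: normalization_def)
      then have "x * y = fls_X ^ c * fps_to_fls (h * g)"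
        by (simp add: h fls_times_fps_to_fls mult.assoc)
      then show ?thesis using inR by simp
    qed
    ultimately show "x \<in> conductor R" by (auto simp: conductor_def colon_def)
  qed
qed

end

theory Submission
  imports Defs
begin

text \<open>
  All modules involved are spaces of series supported in a set \<open>S\<close> of exponents, and the length
  or dimension of the quotient of two of them is the cardinality of the difference of the supports.
  Writing \<open>F = c - 1\<close>, the almost Gorenstein condition in type \<open>2\<close> says that there is one more gap
  than there are elements of \<open>H\<close> below \<open>c\<close>. As \<open>h \<mapsto> F - h\<close> embeds the latter into the gaps, exactly
  one gap \<open>x\<close> is missed, and the symmetry of the situation forces \<open>F = 2 x\<close>. The reduced type
  counts the gaps in \<open>[c - e, c - 1]\<close>, where \<open>e\<close> is the multiplicity: a gap \<open>y \<noteq> x\<close> in this window has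
  \<open>F - y \<in> H\<close> and \<open>F - y < e\<close>, so \<open>y = F\<close>. Hence the reduced type is \<open>2\<close> or \<open>1\<close> according to
  whether \<open>x\<close> lies in the window.
\<close>

section \<open>Series with prescribed support\<close>

text \<open>Testing integer exponents also rules out a principal part, so the criterion applies to
  any Laurent series. \<open>S\<close> may be any set of exponents, so that one constant describes
  the ring, its conductor and its shifts alike.\<close>

lemma mem_semigroup_ring_iff:
  "f \<in> semigroup_ring S \<longleftrightarrow> (\<forall>n. fls_nth f n \<noteq> 0 \<longrightarrow> n \<in> int ` S)"
proof
  assume "f \<in> semigroup_ring S"
  then obtain g where g: "f = fps_to_fls g" "\<forall>n. fps_nth g n \<noteq> 0 \<longrightarrow> n \<in> S"
    by (auto simp: semigroup_ring_def)
  show "\<forall>n. fls_nth f n \<noteq> 0 \<longrightarrow> n \<in> int ` S"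
  proof (intro allI impI)
    fix n assume "fls_nth f n \<noteq> 0"
    then have "n \<ge> 0" "fps_nth g (nat n) \<noteq> 0"
      by (auto simp: g(1) split: if_splits)
    then show "n \<in> int ` S"
      using g(2) by (intro image_eqI[where x = "nat n"]) auto
  qed
next
  assume f: "\<forall>n. fls_nth f n \<noteq> 0 \<longrightarrow> n \<in> int ` S"
  then have neg: "fls_nth f n = 0" if "n < 0" for n
    using that by fastforce
  have "f = fps_to_fls (fls_regpart f)"
    by (intro fls_eqI) (auto simp: neg)
  moreover have "n \<in> S" if "fps_nth (fls_regpart f) n \<noteq> 0" for n
    using f that by auto
  ultimately show "f \<in> semigroup_ring S"
    unfolding semigroup_ring_def by blast
qed

lemma fps_to_fls_mem_semigroup_ring_iff:
  "fps_to_fls f \<in> semigroup_ring S \<longleftrightarrow> (\<forall>n. fps_nth f n \<noteq> 0 \<longrightarrow> n \<in> S)"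
  by (auto simp: semigroup_ring_def fps_to_fls_eq_iff)

lemma semigroup_ring_mono: "S \<subseteq> T \<Longrightarrow> semigroup_ring S \<subseteq> semigroup_ring T"
  by (auto simp: semigroup_ring_def)

lemma fls_X_power_mem_semigroup_ring_iff:
  "fls_X ^ n \<in> semigroup_ring S \<longleftrightarrow> n \<in> S"
  by (auto simp: mem_semigroup_ring_iff)

lemma semigroup_ring_strict_mono:
  assumes "S \<subset> T"
  shows "semigroup_ring S \<subset> semigroup_ring T"
  using assms semigroup_ring_mono[of S T] fls_X_power_mem_semigroup_ring_iff by blast

lemma semigroup_ring_UNIV: "semigroup_ring UNIV = normalization"
  by (auto simp: semigroup_ring_def normalization_def)

lemma fls_X_power_times_semigroup_ring:
  "(fls_X ^ e) *o semigroup_ring S = semigroup_ring ((+) e ` S)"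
proof (intro equalityI subsetI)
  fix f assume "f \<in> (fls_X ^ e) *o (semigroup_ring S :: 'a fls set)"
  then obtain g where g: "g \<in> semigroup_ring S" "f = fls_X ^ e * g"
    by (auto simp: elt_set_times_def)
  have "f = fls_shift (- int e) g"
    by (simp add: g(2) fls_X_power_times_conv_shift)
  then show "f \<in> semigroup_ring ((+) e ` S)"
    using g(1) by (force simp: mem_semigroup_ring_iff)
next
  fix f :: "'a fls" assume f: "f \<in> semigroup_ring ((+) e ` S)"
  have "fls_shift (int e) f \<in> semigroup_ring S"
    using f by (force simp: mem_semigroup_ring_iff)
  moreover have "f = fls_X ^ e * fls_shift (int e) f"
    by (simp add: fls_X_power_times_conv_shift)
  ultimately show "f \<in> (fls_X ^ e) *o semigroup_ring S"
    by (auto simp: elt_set_times_def)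
qed

lemma semigroup_ring_plus:
  "semigroup_ring S + semigroup_ring T = (semigroup_ring (S \<union> T) :: 'k::field fls set)"
proof (intro equalityI subsetI)
  fix f :: "'k fls" assume "f \<in> semigroup_ring S + semigroup_ring T"
  then obtain g h where "f = g + h" "g \<in> semigroup_ring S" "h \<in> semigroup_ring T"
    by (auto simp: set_plus_def)
  then show "f \<in> semigroup_ring (S \<union> T)"
    using semigroup_ring_mono[of S "S \<union> T"] semigroup_ring_mono[of T "S \<union> T"]
    by (auto intro: semigroup_ring_add)
next
  fix f :: "'k fls" assume "f \<in> semigroup_ring (S \<union> T)"
  then obtain p where p: "f = fps_to_fls p" "\<forall>n. fps_nth p n \<noteq> 0 \<longrightarrow> n \<in> S \<union> T"
    by (auto simp: semigroup_ring_def)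
  \<comment> \<open>Exponents common to \<open>S\<close> and \<open>T\<close> all go to
    \<open>q\<close>, so the remainder \<open>p - q\<close> is supported in
    \<open>T\<close>.\<close>
  define q where "q = Abs_fps (\<lambda>n. if n \<in> S then fps_nth p n else 0)"
  have "fps_to_fls q \<in> semigroup_ring S" "fps_to_fls (p - q) \<in> semigroup_ring T"
    using p(2) by (auto simp: fps_to_fls_mem_semigroup_ring_iff q_def
        simp del: fps_to_fls_minus split: if_splits)
  moreover have "f = fps_to_fls q + fps_to_fls (p - q)"
    by (simp add: p(1))
  ultimately show "f \<in> semigroup_ring S + semigroup_ring T"
    by (metis set_plus_intro)
qed

lemma is_submodule_semigroup_ring:
  assumes "\<And>h s. h \<in> H \<Longrightarrow> s \<in> S \<Longrightarrow> h + s \<in> S"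
  shows "is_submodule (semigroup_ring H) (semigroup_ring S :: 'k::field fls set)"
  unfolding is_submodule_def
proof (intro conjI ballI)
  fix f g :: "'k fls" assume "f \<in> semigroup_ring H" "g \<in> semigroup_ring S"
  then obtain p q where p: "f = fps_to_fls p" "\<forall>n. fps_nth p n \<noteq> 0 \<longrightarrow> n \<in> H"
    and q: "g = fps_to_fls q" "\<forall>n. fps_nth q n \<noteq> 0 \<longrightarrow> n \<in> S"
    by (auto simp: semigroup_ring_def)
  have "n \<in> S" if nz: "fps_nth (p * q) n \<noteq> 0" for n
  proof -
    obtain i where i: "i \<le> n" "fps_nth p i * fps_nth q (n - i) \<noteq> 0"
      using nz unfolding fps_mult_nth by (meson atLeastAtMost_iff sum.neutral)
    then have "i + (n - i) \<in> S" using p q by (intro assms) auto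
    then show ?thesis using i by simp
  qed
  then show "f * g \<in> semigroup_ring S"
    unfolding semigroup_ring_def p(1) q(1)
    by (intro image_eqI[where x = "p * q"]) (auto simp: fls_times_fps_to_fls)
qed (auto intro: semigroup_ring_0 semigroup_ring_add)

section \<open>Dimension and length of quotients\<close>

text \<open>Makes the bound on independent sets in a finitely spanned space available for Laurent
  series over the constants.\<close>

interpretation fls_vs: vector_space "\<lambda>(c::'k::field) f. fls_const c * f"
  by unfold_locales (simp_all add: algebra_simps flip: fls_plus_const)

text \<open>Truncation to the exponents in \<open>S - T\<close> is linear, and a series supported in
  \<open>S\<close> that it kills is supported in \<open>T\<close>. Independence modulo the latter
  series thus becomes ordinary independence in the span of finitely many monomials.\<close>

lemma card_le_of_indep_modulo:
  fixes B :: "'k::field fls set"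
  assumes fin: "finite (S - T)" and BS: "B \<subseteq> semigroup_ring S"
    and ind: "indep_modulo (semigroup_ring T) B"
  shows "card B \<le> card (S - T)"
proof -
  define \<pi> :: "'k fls \<Rightarrow> 'k fls" where
    "\<pi> f = (\<Sum>n\<in>S - T. fls_const (fls_nth f (int n)) * fls_X ^ n)" for f
  have \<pi>_nth: "fls_nth (\<pi> f) m = (if m \<in> int ` (S - T) then fls_nth f m else 0)" for f m
  proof -
    have "fls_nth (\<pi> f) m = (\<Sum>n\<in>S - T. if m = int n then fls_nth f (int n) else 0)"
      unfolding \<pi>_def fls_nth_sum by (intro sum.cong) auto
    also have "\<dots> = (\<Sum>i\<in>int ` (S - T). if m = i then fls_nth f i else 0)"
      by (subst sum.reindex) auto
    also have "\<dots> = (if m \<in> int ` (S - T) then fls_nth f m else 0)"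
      using fin by simp
    finally show ?thesis .
  qed
  have ker: "f \<in> semigroup_ring T" if "f \<in> semigroup_ring S" "\<pi> f = 0" for f
  proof -
    have "fls_nth f m = 0" if "m \<in> int ` (S - T)" for m
      using \<pi>_nth[of f m] \<open>\<pi> f = 0\<close> that by simp
    then show ?thesis
      using that(1) unfolding mem_semigroup_ring_iff by blast
  qed
  have finB: "finite B" using ind by (simp add: indep_modulo_def)
  have \<pi>_sum: "\<pi> (\<Sum>b\<in>B. fls_const (u b) * b) = (\<Sum>b\<in>B. fls_const (u b) * \<pi> b)" for u
    by (intro fls_eqI) (simp add: \<pi>_nth fls_nth_sum)
  have sumS: "(\<Sum>b\<in>B. fls_const (u b) * b) \<in> semigroup_ring S" for u
    unfolding mem_semigroup_ring_iff fls_nth_sum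
  proof (intro allI impI)
    fix m assume "(\<Sum>b\<in>B. fls_nth (fls_const (u b) * b) m) \<noteq> 0"
    then obtain b where "b \<in> B" "fls_nth (fls_const (u b) * b) m \<noteq> 0"
      by (meson sum.neutral)
    then show "m \<in> int ` S" using BS by (auto simp: mem_semigroup_ring_iff)
  qed
  have indep: "\<forall>b\<in>B. u b = 0" if "(\<Sum>b\<in>B. fls_const (u b) * \<pi> b) = 0" for u
    using ind ker[OF sumS[of u]] that unfolding indep_modulo_def \<pi>_sum by blast
  \<comment> \<open>Two elements of \<open>B\<close> with the same truncation would satisfy a
    relation with coefficients 1 and -1. Injectivity keeps the cardinality of \<open>B\<close> on
    passing to the image.\<close>
  have inj: "inj_on \<pi> B"
  proof (rule inj_onI, rule ccontr)
    fix x y assume xy: "x \<in> B" "y \<in> B" "\<pi> x = \<pi> y" "x \<noteq> y"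
    define u where "u b = (if b = x then 1 else if b = y then -1 else 0 :: 'k)" for b
    have "(\<Sum>b\<in>B. fls_const (u b) * \<pi> b) = (\<Sum>b\<in>{x, y}. fls_const (u b) * \<pi> b)"
      using xy finB by (intro sum.mono_neutral_right) (auto simp: u_def)
    also have "\<dots> = 0" using xy by (simp add: u_def flip: fls_const_uminus)
    finally have "u x = 0" using indep xy by blast
    then show False by (simp add: u_def)
  qed
  have "fls_vs.independent (\<pi> ` B)"
  proof (rule fls_vs.independent_if_scalars_zero)
    fix u x assume 0: "(\<Sum>x\<in>\<pi> ` B. fls_const (u x) * x) = 0" and x: "x \<in> \<pi> ` B"
    have "(\<Sum>b\<in>B. fls_const (u (\<pi> b)) * \<pi> b) = 0"
      using 0 by (simp add: sum.reindex[OF inj])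
    then show "u x = 0" using indep[of "u \<circ> \<pi>"] x by auto
  qed (use finB in simp)
  moreover have "\<pi> ` B \<subseteq> fls_vs.span ((\<lambda>n. fls_X ^ n) ` (S - T))"
    unfolding \<pi>_def
    by (intro image_subsetI fls_vs.span_sum fls_vs.span_scale) (auto intro: fls_vs.span_base)
  ultimately have "card (\<pi> ` B) \<le> card ((\<lambda>n. fls_X ^ n :: 'k fls) ` (S - T))"
    using fls_vs.independent_span_bound fin by blast
  also have "\<dots> \<le> card (S - T)" using fin by (rule card_image_le)
  finally show ?thesis by (simp add: card_image inj)
qed

text \<open>The bound of \<open>card_le_of_indep_modulo\<close> is attained by the monomials with
  exponents in \<open>S - T\<close>.\<close>

lemma quot_dim_semigroup_ring:
  assumes fin: "finite (S - T)"
  shows "quot_dim (semigroup_ring S) (semigroup_ring T :: 'k::field fls set) = enat (card (S - T))"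
proof (rule antisym)
  show "quot_dim (semigroup_ring S) (semigroup_ring T :: 'k fls set) \<le> enat (card (S - T))"
    unfolding quot_dim_def using card_le_of_indep_modulo[OF fin] by (intro Sup_least) auto
  define B where "B = (\<lambda>n. fls_X ^ n :: 'k fls) ` (S - T)"
  have inj: "inj_on (\<lambda>n. fls_X ^ n :: 'k fls) A" for A
  proof (rule inj_onI)
    fix m n assume "fls_X ^ m = (fls_X ^ n :: 'k fls)"
    then have "fls_nth (fls_X ^ m :: 'k fls) (int m) = fls_nth (fls_X ^ n) (int m)" by simp
    then show "m = n" by (simp split: if_splits)
  qed
  have "indep_modulo (semigroup_ring T) B"
    unfolding indep_modulo_def
  proof (intro conjI allI impI)
    show "finite B" using fin by (simp add: B_def)
    fix u assume u: "(\<Sum>b\<in>B. fls_const (u b) * b) \<in> semigroup_ring T"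
    have nth: "fls_nth (\<Sum>b\<in>B. fls_const (u b) * b) (int m) = u (fls_X ^ m)" if "m \<in> S - T" for m
    proof -
      have "fls_nth (\<Sum>b\<in>B. fls_const (u b) * b) (int m)
          = (\<Sum>n\<in>S - T. if m = n then u (fls_X ^ n) else 0)"
        unfolding B_def sum.reindex[OF inj] o_def fls_nth_sum
        by (intro sum.cong) auto
      then show ?thesis using fin that by simp
    qed
    show "\<forall>b\<in>B. u b = 0"
    proof
      fix b assume "b \<in> B"
      then obtain m where m: "m \<in> S - T" "b = fls_X ^ m" by (auto simp: B_def)
      have "fls_nth (\<Sum>b\<in>B. fls_const (u b) * b) (int m) = 0"
        using u[unfolded mem_semigroup_ring_iff, THEN spec, of "int m"] m(1) by fastforce
      then show "u b = 0" using nth m by simp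
    qed
  qed
  moreover have "B \<subseteq> semigroup_ring S"
    by (auto simp: B_def fls_X_power_mem_semigroup_ring_iff)
  moreover have "card B = card (S - T)" by (simp add: B_def card_image inj)
  ultimately show "enat (card (S - T)) \<le> quot_dim (semigroup_ring S) (semigroup_ring T :: 'k fls set)"
    unfolding quot_dim_def by (intro Sup_upper) (metis (mono_tags, lifting) mem_Collect_eq)
qed

text \<open>As \<open>R\<close> contains the constants, the members of a chain of submodules are
  subspaces. One new vector chosen at each strict inclusion yields a family independent modulo the
  bottom.\<close>

lemma quot_length_le_quot_dim:
  fixes R M N :: "'k::field fls set"
  assumes R: "range fls_const \<subseteq> R"
  shows "quot_length R M N \<le> quot_dim M N"
  unfolding quot_length_def
proof (rule Sup_least, clarify)
  fix l :: nat and P :: "nat \<Rightarrow> 'k fls set"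
  assume sub: "\<forall>i\<le>l. is_submodule R (P i)" and strict: "\<forall>i<l. P i \<subset> P (Suc i)"
  have scale: "fls_const u * x \<in> P i" if "x \<in> P i" "i \<le> l" for u x i
    using sub that R unfolding is_submodule_def by blast
  have "\<exists>B\<subseteq>P j. indep_modulo (P 0) B \<and> card B = j" if "j \<le> l" for j
    using that
  proof (induction j)
    case 0
    then show ?case by (intro exI[of _ "{}"]) (simp add: indep_modulo_def)
  next
    case (Suc j)
    then obtain B where B: "B \<subseteq> P j" "indep_modulo (P 0) B" "card B = j" by auto
    obtain b where b: "b \<in> P (Suc j)" "b \<notin> P j"
      using strict Suc.prems by (meson Suc_le_eq psubset_imp_ex_mem Diff_iff)
    have mono: "P 0 \<subseteq> P j" using Suc.prems strict
    proof (induction j)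
      case (Suc j)
      then show ?case by (meson Suc_leD Suc_le_eq order.trans psubsetE)
    qed simp
    have finB: "finite B" using B by (simp add: indep_modulo_def)
    have bB: "b \<notin> B" using B b by blast
    have sum: "(\<Sum>x\<in>B. fls_const (u x) * x) \<in> P j" for u
      using finB B(1) Suc.prems
      by (induction B) (use sub scale in \<open>auto simp: is_submodule_def\<close>)
    have "indep_modulo (P 0) (insert b B)"
      unfolding indep_modulo_def
    proof (intro conjI allI impI)
      fix u assume u: "(\<Sum>x\<in>insert b B. fls_const (u x) * x) \<in> P 0"
      have eq: "(\<Sum>x\<in>insert b B. fls_const (u x) * x)
          = fls_const (u b) * b + (\<Sum>x\<in>B. fls_const (u x) * x)"
        using finB bB by simp
      \<comment> \<open>Otherwise, subtracting the part from \<open>B\<close>, which lies in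
        \<open>P j\<close>, and dividing by \<open>u b\<close> would put \<open>b\<close> into
        \<open>P j\<close>.\<close>
      have ub: "u b = 0"
      proof (rule ccontr)
        assume ub: "u b \<noteq> 0"
        have "(\<Sum>x\<in>insert b B. fls_const (u x) * x) + fls_const (-1) * (\<Sum>x\<in>B. fls_const (u x) * x)
            \<in> P j"
          using u mono sum scale sub Suc.prems unfolding is_submodule_def
          by (meson Suc_leD subsetD)
        then have "fls_const (u b) * b \<in> P j"
          by (simp add: eq flip: fls_const_uminus)
        then have "fls_const (inverse (u b)) * (fls_const (u b) * b) \<in> P j"
          using scale Suc.prems by (meson Suc_leD)
        then show False
          using b ub by (simp add: fls_const_mult_const flip: mult.assoc)
      qed
      then have "\<forall>x\<in>B. u x = 0" using u B(2) eq by (simp add: indep_modulo_def)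
      then show "\<forall>x\<in>insert b B. u x = 0" using ub by simp
    qed (use finB in simp)
    moreover have "insert b B \<subseteq> P (Suc j)"
      using b(1) B(1) strict Suc.prems by (metis Suc_le_eq insert_subset order.trans psubsetE)
    ultimately show ?case using B(3) bB finB by (intro exI[of _ "insert b B"]) simp
  qed
  then obtain B where "B \<subseteq> P l" "indep_modulo (P 0) B" "card B = l" by blast
  then show "enat l \<le> quot_dim (P l) (P 0)"
    unfolding quot_dim_def by (intro Sup_upper) blast
qed

text \<open>The length is at most the dimension; conversely, removing the exponents in
  \<open>S - T\<close> one at a time gives a chain with that many strict steps.\<close>

lemma quot_length_semigroup_ring:
  fixes H S T :: "nat set"
  assumes H: "0 \<in> H" and TS: "T \<subseteq> S" and fin: "finite (S - T)"
    and S: "\<And>h s. h \<in> H \<Longrightarrow> s \<in> S \<Longrightarrow> h + s \<in> S"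
    and T: "\<And>h s. h \<in> H \<Longrightarrow> s \<in> T \<Longrightarrow> h + s \<in> T"
  shows "quot_length (semigroup_ring H) (semigroup_ring S) (semigroup_ring T :: 'k::field fls set)
    = enat (card (S - T))"
proof (rule antisym)
  have "range fls_const \<subseteq> (semigroup_ring H :: 'k fls set)"
    using H by (auto simp: mem_semigroup_ring_iff)
  then show "quot_length (semigroup_ring H) (semigroup_ring S) (semigroup_ring T :: 'k fls set)
    \<le> enat (card (S - T))"
    by (rule order_trans[OF quot_length_le_quot_dim eq_refl[OF quot_dim_semigroup_ring[OF fin]]])
  have chain: "\<exists>Q. Q 0 = T \<and> Q l = S \<and> (\<forall>i\<le>l. \<forall>h\<in>H. \<forall>s\<in>Q i. h + s \<in> Q i) \<and> (\<forall>i<l. Q i \<subset> Q (Suc i))"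
    if "card (S - T) = l" for l
    using that TS fin S
  proof (induction l arbitrary: S)
    case 0
    then have "S = T" by auto
    then show ?case using 0 by (intro exI[of _ "\<lambda>_. S"]) auto
  next
    case (Suc l)
    \<comment> \<open>Removing the least exponent of \<open>S - T\<close> preserves stability under
      \<open>H\<close>: if \<open>h + s = m\<close> with \<open>s \<noteq> m\<close>, then
      \<open>s < m\<close>, so \<open>s\<close> lies in \<open>T\<close>, and hence \<open>m\<close>
      would too.\<close>
    define m where "m = (LEAST m. m \<in> S - T)"
    have "S - T \<noteq> {}" using Suc.prems by force
    then have m: "m \<in> S - T" unfolding m_def by (metis LeastI ex_in_conv)
    have m_le: "m \<le> s" if "s \<in> S - T" for s unfolding m_def using that by (rule Least_le)
    have stable: "h + s \<in> S - {m}" if "h \<in> H" "s \<in> S - {m}" for h s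
    proof -
      have "h + s \<noteq> m"
      proof
        assume eq: "h + s = m"
        then have "s < m" using that by (cases h) auto
        then have "s \<in> T" using m_le[of s] that by auto
        then show False using T[of h s] that eq m by simp
      qed
      then show ?thesis using Suc.prems(4) that by simp
    qed
    have "S - {m} - T = S - T - {m}" by blast
    then have "card (S - {m} - T) = l"
      using Suc.prems(1) m by simp
    moreover have "T \<subseteq> S - {m}" "finite (S - {m} - T)"
      using Suc.prems(2,3) m by (auto intro: finite_subset)
    ultimately obtain Q where Q: "Q 0 = T" "Q l = S - {m}"
      "\<forall>i\<le>l. \<forall>h\<in>H. \<forall>s\<in>Q i. h + s \<in> Q i" "\<forall>i<l. Q i \<subset> Q (Suc i)"
      using Suc.IH[of "S - {m}"] stable by blast
    show ?case
    proof (intro exI[of _ "Q(Suc l := S)"] conjI)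
      show "\<forall>i\<le>Suc l. \<forall>h\<in>H. \<forall>s\<in>(Q(Suc l := S)) i. h + s \<in> (Q(Suc l := S)) i"
        using Q(3) Suc.prems(4) by (auto simp: le_Suc_eq)
      show "\<forall>i<Suc l. (Q(Suc l := S)) i \<subset> (Q(Suc l := S)) (Suc i)"
        using Q(2,4) m by (auto simp: less_Suc_eq)
    qed (use Q(1) in auto)
  qed
  obtain Q where Q: "Q 0 = T" "Q (card (S - T)) = S"
    "\<forall>i\<le>card (S - T). \<forall>h\<in>H. \<forall>s\<in>Q i. h + s \<in> Q i" "\<forall>i<card (S - T). Q i \<subset> Q (Suc i)"
    using chain[OF refl] by blast
  define P where "P i = (semigroup_ring (Q i) :: 'k fls set)" for i
  have P: "P 0 = semigroup_ring T" "P (card (S - T)) = semigroup_ring S"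
    by (simp_all add: P_def Q)
  have sub: "\<forall>i\<le>card (S - T). is_submodule (semigroup_ring H) (P i)"
    using Q(3) unfolding P_def by (intro allI impI is_submodule_semigroup_ring) blast
  have strict: "\<forall>i<card (S - T). P i \<subset> P (Suc i)"
    using Q(4) unfolding P_def by (intro allI impI semigroup_ring_strict_mono) blast
  show "enat (card (S - T))
    \<le> quot_length (semigroup_ring H) (semigroup_ring S) (semigroup_ring T :: 'k fls set)"
    unfolding quot_length_def
    by (intro Sup_upper CollectI exI[of _ "card (S - T)"] exI[of _ P] conjI refl P sub strict)
qed

section \<open>Numerical semigroups\<close>

lemma conductor_val_add:
  assumes "numerical_semigroup H"
  shows "conductor_val H + i \<in> H"
proof -
  have "finite (UNIV - H)" using assms by (simp add: numerical_semigroup_def)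
  then obtain b where b: "\<forall>x\<in>UNIV - H. x < b" using finite_nat_set_iff_bounded by blast
  have "b + i \<in> H" for i using b[rule_format, of "b + i"] by auto
  then have "\<exists>c. \<forall>i. c + i \<in> H" by blast
  then show ?thesis unfolding conductor_val_def by (rule LeastI2_ex) blast
qed

text \<open>This is the Frobenius number, the largest gap. Positivity ensures that the subtraction
  of 1 is not truncated.\<close>

lemma pred_conductor_val_notin:
  assumes H: "numerical_semigroup H" and "H \<noteq> UNIV"
  shows "conductor_val H > 0" "conductor_val H - 1 \<notin> H"
proof -
  show pos: "conductor_val H > 0"
    using conductor_val_add[OF H] assms(2) by (metis UNIV_eq_I add.left_neutral gr0I)
  have "\<not> (\<forall>i. conductor_val H - 1 + i \<in> H)"
    unfolding conductor_val_def using pos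
    by (intro not_less_Least) (simp add: conductor_val_def)
  then obtain i where i: "conductor_val H - 1 + i \<notin> H" by blast
  then have "i = 0" using conductor_val_add[OF H, of "i - 1"] pos by (cases i) auto
  then show "conductor_val H - 1 \<notin> H" using i by simp
qed

lemma submonoid_generated_least:
  "A \<subseteq> M \<Longrightarrow> 0 \<in> M \<Longrightarrow> (\<And>x y. x \<in> M \<Longrightarrow> y \<in> M \<Longrightarrow> x + y \<in> M) \<Longrightarrow> submonoid_generated A \<subseteq> M"
  by (auto simp: submonoid_generated_def)

text \<open>Zero lies in every submonoid, so deleting it from a generating set does not change what
  is generated.\<close>

lemma zero_notin_minimal_generators:
  assumes "minimally_generates A H"
  shows "0 \<notin> A"
proof
  assume "0 \<in> A"
  then have "A - {0} \<subset> A" by blast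
  moreover have "submonoid_generated (A - {0}) = submonoid_generated A"
    unfolding submonoid_generated_def by (rule arg_cong[of _ _ Inter]) blast
  ultimately show False using assms unfolding minimally_generates_def by blast
qed

text \<open>Zero and the numbers from \<open>a 1\<close> on form a submonoid containing every
  generator, so \<open>a 1\<close> is the multiplicity.\<close>

lemma first_generator_is_multiplicity:
  fixes a :: "nat \<Rightarrow> nat"
  assumes H: "numerical_semigroup H" and a: "strict_mono_on {1..n} a"
    and gen: "minimally_generates (a ` {1..n}) H"
  shows "a 1 > 0" "\<And>h. h \<in> H \<Longrightarrow> h > 0 \<Longrightarrow> a 1 \<le> h"
proof -
  have span: "submonoid_generated (a ` {1..n}) = H"
    using gen by (simp add: minimally_generates_def)
  \<comment> \<open>For \<open>n = 0\<close> the value \<open>a 1\<close> would be unrelated to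
    \<open>H\<close>; this case is excluded because \<open>{0}\<close> has infinite
    complement.\<close>
  have "H \<noteq> {0}"
    using H by (auto simp: numerical_semigroup_def)
  moreover have "submonoid_generated (a ` {1..n}) \<subseteq> {0}" if "n = 0"
    using that by (intro submonoid_generated_least) auto
  ultimately have n: "n \<ge> 1"
    using span H by (cases n) (auto simp: numerical_semigroup_def)
  then have "a 1 \<in> a ` {1..n}" by simp
  then show "a 1 > 0" using zero_notin_minimal_generators[OF gen] by (metis gr0I)
  have "a 1 \<le> a i" if "i \<in> {1..n}" for i
    using strict_mono_onD[OF a, of 1 i] that n by (cases "i = 1") auto
  then have "submonoid_generated (a ` {1..n}) \<subseteq> {h. h = 0 \<or> a 1 \<le> h}"
    by (intro submonoid_generated_least) auto
  then show "a 1 \<le> h" if "h \<in> H" "h > 0" for h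
    using that span by auto
qed

text \<open>Semigroups satisfying the cardinality hypothesis are usually called pseudo-symmetric.\<close>

lemma pseudo_symmetric:
  fixes H :: "nat set" and F :: nat
  assumes add: "\<And>x y. x \<in> H \<Longrightarrow> y \<in> H \<Longrightarrow> x + y \<in> H"
    and F: "F \<notin> H" and above: "\<And>x. x > F \<Longrightarrow> x \<in> H"
    and card: "card (- H) = card (H \<inter> {..F}) + 1"
  obtains x where "F = 2 * x" "x \<notin> H" "\<And>y. y \<notin> H \<Longrightarrow> y \<noteq> x \<Longrightarrow> F - y \<in> H"
proof -
  define N where "N = (\<lambda>h. F - h) ` (H \<inter> {..F})"
  have gap_le: "y \<le> F" if "y \<notin> H" for y using above that by (meson not_le)
  \<comment> \<open>The reflection of an element of \<open>H\<close> is a gap, since otherwise the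
    two would add up to \<open>F\<close> inside \<open>H\<close>.\<close>
  have NG: "N \<subseteq> - H"
  proof
    fix y assume "y \<in> N"
    then obtain h where h: "h \<in> H" "h \<le> F" "y = F - h" by (auto simp: N_def)
    then have "y \<in> H \<Longrightarrow> F \<in> H" using add[of y h] by simp
    then show "y \<in> - H" using F by blast
  qed
  have "inj_on (\<lambda>h. F - h) (H \<inter> {..F})" by (auto simp: inj_on_def)
  then have "card N = card (H \<inter> {..F})" by (simp add: N_def card_image)
  \<comment> \<open>An infinite set has \<open>card\<close> 0, which the summand 1 in the hypothesis
    excludes.\<close>
  moreover have "finite (- H)" using card by (metis add_is_0 card.infinite one_neq_zero)
  ultimately have "card (- H - N) = 1" using card NG by (simp add: card_Diff_subset finite_subset)
  then obtain x where x: "- H - N = {x}" by (meson card_1_singletonE)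
  have mem_N: "y \<in> N" if "y \<notin> H" "F - y \<in> H" for y
    unfolding N_def using that gap_le[of y] by (intro image_eqI[where x = "F - y"]) auto
  have refl: "F - y \<in> H" if "y \<in> N" for y
    using that by (auto simp: N_def)
  have xH: "x \<notin> H" "x \<notin> N" using x by auto
  \<comment> \<open>The reflection of \<open>x\<close> is again a gap outside \<open>N\<close>. As
    \<open>x\<close> is the only such gap, it is its own reflection.\<close>
  have "F - x \<notin> H" using mem_N xH by blast
  moreover have "F - x \<notin> N" using refl[of "F - x"] xH gap_le[of x] by auto
  ultimately have "F - x = x" using x by blast
  then have "F = 2 * x" using gap_le[OF xH(1)] by simp
  moreover have "F - y \<in> H" if "y \<notin> H" "y \<noteq> x" for y
    using that x refl by blast
  ultimately show thesis using xH that by blast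
qed

text \<open>This count is the reduced type. Shifting down by \<open>e\<close> turns the counted
  exponents into the gaps from \<open>c - e\<close> on.\<close>

lemma pseudo_symmetric_card_gaps:
  fixes H :: "nat set" and e x c :: nat
  assumes c: "c = 2 * x + 1" and above: "\<And>i. c + i \<in> H" and gap: "2 * x \<notin> H" "x \<notin> H"
    and sym: "\<And>y. y \<notin> H \<Longrightarrow> y \<noteq> x \<Longrightarrow> 2 * x - y \<in> H"
    and zero: "0 \<in> H" and e: "e > 0" "\<And>h. h \<in> H \<Longrightarrow> h > 0 \<Longrightarrow> e \<le> h"
  shows "card ({c..} - (+) e ` H) = (if c \<le> 2 * e - 1 then 2 else 1)"
proof -
  have x: "x > 0" using zero gap by (metis gr0I)
  \<comment> \<open>Guarantees that every exponent from \<open>c\<close> on can be written as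
    \<open>y + e\<close> with a natural number \<open>y\<close>.\<close>
  have ec: "e \<le> c" using e(2)[of c] above[of 0] c by simp
  have iff: "y + e \<in> {c..} - (+) e ` H \<longleftrightarrow> c \<le> y + e \<and> y \<notin> H" for y
    by (auto simp: add.commute)
  have "{c..} - (+) e ` H = {y. (y = 2 * x + e \<or> y = x + e) \<and> c \<le> y}"
  proof (intro equalityI subsetI)
    fix z assume z: "z \<in> {c..} - (+) e ` H"
    then obtain y where y: "z = y + e"
      using ec by (metis Diff_iff add.commute atLeast_iff le_Suc_ex order.trans)
    have yH: "y \<notin> H" "c \<le> y + e" using z iff y by auto
    have "y < c" using yH(1) above[of "y - c"] by (metis le_add_diff_inverse not_le)
    have "y = 2 * x" if "y \<noteq> x"
    proof (rule ccontr)
      assume "y \<noteq> 2 * x"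
      \<comment> \<open>From \<open>c = 2 * x + 1 \<le> y + e\<close> the reflection of
        \<open>y\<close> is below \<open>e\<close>; it would be a positive element of
        \<open>H\<close> under the multiplicity.\<close>
      then have "2 * x - y > 0" "2 * x - y < e" using \<open>y < c\<close> yH(2) c by auto
      then show False using sym[OF yH(1) that] e(2) by force
    qed
    then show "z \<in> {y. (y = 2 * x + e \<or> y = x + e) \<and> c \<le> y}"
      using y yH(2) by auto
  next
    fix z assume "z \<in> {y. (y = 2 * x + e \<or> y = x + e) \<and> c \<le> y}"
    then show "z \<in> {c..} - (+) e ` H" using iff gap by auto
  qed
  \<comment> \<open>The exponent \<open>2 * x + e\<close> always reaches \<open>c\<close> because
    \<open>e \<ge> 1\<close>, whereas \<open>x + e\<close> does so exactly when
    \<open>x < e\<close>, that is, \<open>2 * x + 1 \<le> 2 * e - 1\<close>. The two are distinct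
    since \<open>x > 0\<close>.\<close>
  also have "\<dots> = (if c \<le> 2 * e - 1 then {2 * x + e, x + e} else {2 * x + e})"
    using c e(1) by auto
  finally show ?thesis using x by simp
qed

section \<open>Reduced type\<close>

lemma conductor_eq_semigroup_ring:
  assumes "numerical_semigroup H"
  shows "conductor (semigroup_ring H :: 'k::field fls set) = semigroup_ring {conductor_val H..}"
proof -
  have "range ((+) c) = {c..}" for c :: nat
    by (auto simp: image_iff le_iff_add)
  then show ?thesis
    by (simp add: conductor_semigroup_ring[OF assms] fls_X_power_times_semigroup_ring
        flip: semigroup_ring_UNIV)
qed

lemma reduced_type_semigroup_ring:
  assumes H: "numerical_semigroup H"
  shows "reduced_type e (semigroup_ring H :: 'k::field fls set)
    = enat (card ({conductor_val H..} - (+) e ` H))"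
proof -
  \<comment> \<open>The dimension formula needs a finite difference of supports: every exponent from
    \<open>conductor_val H + e\<close> on is \<open>e\<close> plus an element of
    \<open>H\<close>.\<close>
  have "y \<in> {..< conductor_val H + e}" if y: "y \<in> {conductor_val H..} - (+) e ` H" for y
  proof (rule ccontr)
    assume "y \<notin> {..< conductor_val H + e}"
    then have "y = e + (conductor_val H + (y - e - conductor_val H))" by simp
    then have "y \<in> (+) e ` H" using conductor_val_add[OF H] by blast
    then show False using y by blast
  qed
  then have "finite ({conductor_val H..} - (+) e ` H)"
    by (meson finite_lessThan finite_subset subsetI)
  moreover have "{conductor_val H..} \<union> (+) e ` H - (+) e ` H = {conductor_val H..} - (+) e ` H"
    by blast
  ultimately show ?thesis
    by (simp add: reduced_type_def conductor_eq_semigroup_ring[OF H]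
        fls_X_power_times_semigroup_ring semigroup_ring_plus quot_dim_semigroup_ring)
qed

text \<open>The two lengths count the gaps and the elements of \<open>H\<close> below the conductor
  valuation; type 2 leaves an excess of 1.\<close>

lemma almost_gorenstein_type_2_card:
  fixes H :: "nat set"
  assumes H: "numerical_semigroup H"
    and AG: "almost_gorenstein e (semigroup_ring H :: 'k::field fls set)"
    and type: "cm_type e (semigroup_ring H :: 'k fls set) = 2"
  shows "card (- H) = card (H \<inter> {..<conductor_val H}) + 1"
proof -
  let ?R = "semigroup_ring H :: 'k fls set"
  have zero: "0 \<in> H" and add: "\<And>x y. x \<in> H \<Longrightarrow> y \<in> H \<Longrightarrow> x + y \<in> H" and fin: "finite (UNIV - H)"
    using H by (auto simp: numerical_semigroup_def)
  have "quot_length ?R normalization ?R = enat (card (- H))"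
    using quot_length_semigroup_ring[OF zero _ fin _ add]
    by (simp add: semigroup_ring_UNIV Compl_eq_Diff_UNIV)
  moreover have diff: "H - {conductor_val H..} = H \<inter> {..<conductor_val H}"
    by auto
  have "quot_length ?R ?R (conductor ?R) = enat (card (H \<inter> {..<conductor_val H}))"
    unfolding conductor_eq_semigroup_ring[OF H] diff[symmetric]
  proof (rule quot_length_semigroup_ring[OF zero _ _ add])
    show "{conductor_val H..} \<subseteq> H"
      using conductor_val_add[OF H] by (metis atLeast_iff le_Suc_ex subsetI)
  qed (auto simp: diff)
  ultimately have "enat (card (- H)) = enat (card (H \<inter> {..<conductor_val H})) + 2 - 1"
    using AG type by (simp add: almost_gorenstein_def)
  then show ?thesis
    by (simp add: one_enat_def numeral_eq_enat)
qed

theorem theorem3: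
  fixes a :: "nat \<Rightarrow> nat" and n c :: nat and H :: "nat set"
    and R :: "'k::{alg_closed_field, field_char_0} fls set"
  assumes "numerical_semigroup H" and "H \<noteq> UNIV"
    and "strict_mono_on {1..n} a" and "minimally_generates (a ` {1..n}) H"
    and "R = semigroup_ring H"
    and "c = conductor_val H"
    and "almost_gorenstein (a 1) R" and "cm_type (a 1) R = 2"
  shows "(maximal_reduced_type (a 1) R \<longleftrightarrow> c \<le> 2 * a 1 - 1) \<and>
         (minimal_reduced_type (a 1) R \<longleftrightarrow> c > 2 * a 1 - 1)"
proof -
  note H = assms(1)
  have zero: "0 \<in> H" and add: "\<And>x y. x \<in> H \<Longrightarrow> y \<in> H \<Longrightarrow> x + y \<in> H"
    using H by (auto simp: numerical_semigroup_def)
  have above: "c + i \<in> H" for i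
    using conductor_val_add[OF H] by (simp add: assms(6))
  have c: "c > 0" and F: "c - 1 \<notin> H"
    using pred_conductor_val_notin[OF H assms(2)] by (simp_all add: assms(6))
  have "card (- H) = card (H \<inter> {..<c}) + 1"
    using almost_gorenstein_type_2_card[OF H] assms(5-8) by metis
  \<comment> \<open>Passes from the conductor valuation to the Frobenius number, the centre of the
    reflection being half of it.\<close>
  also have "{..<c} = {..c - 1}" using c by auto
  finally have card: "card (- H) = card (H \<inter> {..c - 1}) + 1" .
  have gt: "y \<in> H" if "y > c - 1" for y
    using above[of "y - c"] that c by simp
  obtain x where x: "c - 1 = 2 * x" "x \<notin> H" "\<And>y. y \<notin> H \<Longrightarrow> y \<noteq> x \<Longrightarrow> c - 1 - y \<in> H"
    using pseudo_symmetric[OF add F gt card] by blast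
  have "card ({c..} - (+) (a 1) ` H) = (if c \<le> 2 * a 1 - 1 then 2 else 1)"
    using x c F above zero first_generator_is_multiplicity[OF H assms(3,4)]
    by (intro pseudo_symmetric_card_gaps[of c x]) auto
  then have "reduced_type (a 1) R = (if c \<le> 2 * a 1 - 1 then 2 else 1)"
    by (simp add: assms(5,6) reduced_type_semigroup_ring[OF H] numeral_eq_enat one_enat_def)
  \<comment> \<open>With type 2, maximality means reduced type 2; as 2 and 1 are the only values,
    the two equivalences are complementary.\<close>
  then show ?thesis
    using assms(8) by (auto simp: maximal_reduced_type_def minimal_reduced_type_def)
qed

end
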